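(* Let $G$ be a finite simple graph on the vertex set $[n]$ which does not have isolated vertices and is not a complete graph. Let $K$ be a field and $S=K[x_1,\dots,x_n]$. Then the following conditions are equivalent: (a) $I_c(G)$ is unmixed; (b) $I_c(G)^\vee=I(G^c)$; (c) $G$ is $K_3$-free.
   Context: $[n]=\{1,\dots,n\}$; $G$ has vertex set $[n]$ and edge set $E(G)$. The complementary edge ideal of $G$ is $I_c(G)=\big((x_1\cdots x_n)/(x_ix_j) : \{i,j\}\in E(G)\big)\subset S$. An ideal is unmixed if all its associated primes have the same height. For non-empty $F\subset[n]$, $P_F=(x_i:i\in F)$; if a squarefree monomial ideal $I$ has minimal primary decomposition $I=\bigcap_{i=1}^m P_{F_i}$, its Alexander dual is $I^\vee=(\prod_{j\in F_1}x_j,\dots,\prod_{j\in F_m}x_j)$. $G^c$ is the complementary graph (same vertex set, edges exactly the pairs $\{i,j\}$, $i\neq j$, not in $E(G)$), and the edge ideal of a graph $H$ on $[n]$ is $I(H)=(x_ix_j:\{i,j\}\in E(H))$. $G$ is $K_3$-free if it contains no three pairwise adjacent vertices. *)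

theory Defs
  imports
    "HOL-Library.Poly_Mapping"
    "HOL-Library.Extended_Nat"
    "HOL-Algebra.Ideal"
begin

text \<open>
  An exponent vector is a finitely supported function \<open>nat \<Rightarrow>\<^sub>0 nat\<close>; a polynomial maps exponent
  vectors to coefficients. The ring \<open>poly_ring n\<close> consists of those polynomials in which only
  the variables with index in \<open>{1..n}\<close> occur.
\<close>

type_synonym 'k mpoly = "(nat \<Rightarrow>\<^sub>0 nat) \<Rightarrow>\<^sub>0 'k"

definition poly_ring :: "nat \<Rightarrow> ('k::field) mpoly ring" where
  "poly_ring n =
     \<lparr> carrier = {p. \<forall>m\<in>Poly_Mapping.keys p. Poly_Mapping.keys m \<subseteq> {1..n}},
       monoid.mult = (*), one = 1, ring.zero = 0, add = (+) \<rparr>"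

definition X :: "nat \<Rightarrow> ('k::field) mpoly" where
  "X i = Poly_Mapping.single (Poly_Mapping.single i 1) 1"

lemma X_in_carrier: "i \<in> {1..n} \<Longrightarrow> X i \<in> carrier (poly_ring n)"
  by (simp add: X_def poly_ring_def)

lemma poly_ring_cring: "cring (poly_ring n :: ('k::field) mpoly ring)"
proof -
  let ?C = "carrier (poly_ring n) :: 'k mpoly set"
  have add: "p + q \<in> ?C" if "p \<in> ?C" "q \<in> ?C" for p q
    using that Poly_Mapping.keys_add[of p q] by (auto simp: poly_ring_def)
  have mult: "p * q \<in> ?C" if "p \<in> ?C" "q \<in> ?C" for p q
  proof -
    have "Poly_Mapping.keys m \<subseteq> {1..n}" if m: "m \<in> Poly_Mapping.keys (p * q)" for m
    proof -
      obtain a b where "m = a + b" "a \<in> Poly_Mapping.keys p" "b \<in> Poly_Mapping.keys q"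
        using m keys_mult[of p q] by blast
      then have "Poly_Mapping.keys a \<subseteq> {1..n}" "Poly_Mapping.keys b \<subseteq> {1..n}"
        "Poly_Mapping.keys m \<subseteq> Poly_Mapping.keys a \<union> Poly_Mapping.keys b"
        using \<open>p \<in> ?C\<close> \<open>q \<in> ?C\<close> Poly_Mapping.keys_add[of a b] by (auto simp: poly_ring_def)
      then show ?thesis by blast
    qed
    then show ?thesis by (simp add: poly_ring_def)
  qed
  have neg: "- p \<in> ?C" if "p \<in> ?C" for p
    using that by (simp add: poly_ring_def)
  have one: "1 \<in> ?C" and zero: "0 \<in> ?C"
    by (auto simp: poly_ring_def)
  let ?R = "poly_ring n :: 'k mpoly ring"
  have ops: "x \<oplus>\<^bsub>?R\<^esub> y = x + y" "x \<otimes>\<^bsub>?R\<^esub> y = x * y" "\<zero>\<^bsub>?R\<^esub> = 0" "\<one>\<^bsub>?R\<^esub> = 1" for x y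
    by (simp_all add: poly_ring_def)
  show ?thesis
  proof (rule cringI)
    show "abelian_group ?R"
    proof (rule abelian_groupI, unfold ops)
      fix x :: "'k mpoly" assume "x \<in> ?C"
      then have "- x \<in> ?C" by (rule neg)
      then show "\<exists>y\<in>?C. y + x = 0" by (intro bexI[of _ "- x"]) auto
    qed (auto intro: add zero simp: add.assoc add.commute)
    show "comm_monoid ?R"
      by (rule comm_monoidI, unfold ops) (auto intro: mult one simp: mult.assoc mult.commute)
  qed (simp add: ops distrib_right)
qed

definition associated_primes :: "('a, 'b) ring_scheme \<Rightarrow> 'a set \<Rightarrow> 'a set set" where
  "associated_primes R I =
     {P. primeideal P R \<and> (\<exists>f\<in>carrier R. P = {r \<in> carrier R. r \<otimes>\<^bsub>R\<^esub> f \<in> I})}"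

definition height :: "('a, 'b) ring_scheme \<Rightarrow> 'a set \<Rightarrow> enat" where
  "height R P =
     Sup {enat k | k. \<exists>Q :: nat \<Rightarrow> 'a set.
            (\<forall>i\<le>k. primeideal (Q i) R) \<and> (\<forall>i<k. Q i \<subset> Q (Suc i)) \<and> Q k = P}"

definition unmixed :: "('a, 'b) ring_scheme \<Rightarrow> 'a set \<Rightarrow> bool" where
  "unmixed R I \<longleftrightarrow>
     (\<forall>P\<in>associated_primes R I. \<forall>Q\<in>associated_primes R I. height R P = height R Q)"

definition radical :: "('a, 'b) ring_scheme \<Rightarrow> 'a set \<Rightarrow> 'a set" where
  "radical R I = {r \<in> carrier R. \<exists>k::nat. r [^]\<^bsub>R\<^esub> k \<in> I}"

definition primary_ideal :: "('a, 'b) ring_scheme \<Rightarrow> 'a set \<Rightarrow> bool" where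
  "primary_ideal R Q \<longleftrightarrow> ideal Q R \<and> Q \<noteq> carrier R \<and>
     (\<forall>a\<in>carrier R. \<forall>b\<in>carrier R. a \<otimes>\<^bsub>R\<^esub> b \<in> Q \<longrightarrow> a \<in> Q \<or> b \<in> radical R Q)"

text \<open>
  Intersecting with the carrier only matters for the empty family, whose intersection
  is the whole ring.
\<close>

definition minimal_primary_decomposition ::
    "('a, 'b) ring_scheme \<Rightarrow> 'a set \<Rightarrow> 'a set set \<Rightarrow> bool" where
  "minimal_primary_decomposition R I Qs \<longleftrightarrow>
     finite Qs \<and> (\<forall>Q\<in>Qs. primary_ideal R Q) \<and> I = carrier R \<inter> \<Inter>Qs \<and>
     inj_on (radical R) Qs \<and> (\<forall>Q\<in>Qs. \<not> carrier R \<inter> \<Inter>(Qs - {Q}) \<subseteq> Q)"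

definition monomial_prime :: "nat \<Rightarrow> nat set \<Rightarrow> ('k::field) mpoly set" where
  "monomial_prime n F = Idl\<^bsub>poly_ring n\<^esub> (X ` F)"

text \<open>
  The family of sets \<open>F\<close> is uniquely determined for every nonzero squarefree monomial
  ideal; for other ideals \<open>alexander_dual\<close> carries no meaning.
\<close>

definition alexander_dual :: "nat \<Rightarrow> ('k::field) mpoly set \<Rightarrow> 'k mpoly set" where
  "alexander_dual n I =
     (let Fs = (THE Fs. Fs \<subseteq> Pow {1..n} - {{}} \<and>
                  minimal_primary_decomposition (poly_ring n) I (monomial_prime n ` Fs))
      in Idl\<^bsub>poly_ring n\<^esub> ((\<lambda>F. \<Prod>j\<in>F. X j) ` Fs))"

text \<open>A graph is given by its set of edges, an edge being a two-element set of vertices.\<close>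

definition simple_graph :: "nat \<Rightarrow> nat set set \<Rightarrow> bool" where
  "simple_graph n E \<longleftrightarrow> (\<forall>e\<in>E. e \<subseteq> {1..n} \<and> card e = 2)"

definition has_isolated_vertex :: "nat \<Rightarrow> nat set set \<Rightarrow> bool" where
  "has_isolated_vertex n E \<longleftrightarrow> (\<exists>i\<in>{1..n}. \<forall>e\<in>E. i \<notin> e)"

definition complete_graph :: "nat \<Rightarrow> nat set set \<Rightarrow> bool" where
  "complete_graph n E \<longleftrightarrow> (\<forall>i\<in>{1..n}. \<forall>j\<in>{1..n}. i \<noteq> j \<longrightarrow> {i, j} \<in> E)"

definition complement_graph :: "nat \<Rightarrow> nat set set \<Rightarrow> nat set set" where
  "complement_graph n E =
     {{i, j} | i j. i \<in> {1..n} \<and> j \<in> {1..n} \<and> i \<noteq> j \<and> {i, j} \<notin> E}"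

definition K3_free :: "nat set set \<Rightarrow> bool" where
  "K3_free E \<longleftrightarrow>
     \<not> (\<exists>i j k. i \<noteq> j \<and> j \<noteq> k \<and> i \<noteq> k \<and> {i, j} \<in> E \<and> {j, k} \<in> E \<and> {i, k} \<in> E)"

definition edge_ideal :: "nat \<Rightarrow> nat set set \<Rightarrow> ('k::field) mpoly set" where
  "edge_ideal n E = Idl\<^bsub>poly_ring n\<^esub> {X i * X j | i j. {i, j} \<in> E}"

text \<open>
  For an edge \<open>{i, j}\<close> the monomial \<open>x\<^sub>1 \<cdots> x\<^sub>n / (x\<^sub>i x\<^sub>j)\<close> is the product of the
  variables other than \<open>x\<^sub>i\<close> and \<open>x\<^sub>j\<close>.
\<close>

definition complementary_edge_ideal :: "nat \<Rightarrow> nat set set \<Rightarrow> ('k::field) mpoly set" where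
  "complementary_edge_ideal n E =
     Idl\<^bsub>poly_ring n\<^esub> {\<Prod>k\<in>{1..n} - {i, j}. X k | i j. {i, j} \<in> E}"

end

theory Submission
  imports Defs "HOL-Computational_Algebra.Polynomial"
begin

text \<open>
  A monomial lies in \<open>I\<^sub>c(G)\<close> exactly when the set \<open>T\<close> of variables missing from it is contained
  in an edge. Since \<open>G\<close> has no isolated vertices, the sets contained in an edge are the faces of
  \<open>G\<close>, seen as a one-dimensional simplicial complex, and the minimal nonfaces of this complex are
  the edges of \<open>G\<^sup>c\<close> and the triangles of \<open>G\<close> (lemma \<open>contained_in_edge_iff\<close>). A set \<open>F\<close> is not
  contained in \<open>T\<close> iff the monomial lies in \<open>P\<^sub>F\<close>, so \<open>I\<^sub>c(G)\<close> is the intersection of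
  the primes \<open>P\<^sub>F\<close> where \<open>F\<close> runs through the edges of \<open>G\<^sup>c\<close> and the triangles of \<open>G\<close>
  (lemma \<open>complementary_edge_ideal_Inter\<close>).

  These sets form an antichain, hence the intersection is irredundant. The associated primes of an
  irredundant finite intersection of primes are the intersected primes themselves (lemma
  \<open>associated_primes_Inter\<close>); in particular the family of these primes is determined by the ideal.
  Consequently the Alexander dual of \<open>I\<^sub>c(G)\<close> is generated by the edges of \<open>G\<^sup>c\<close> together with
  the triangles of \<open>G\<close>. A triangle contains no edge of \<open>G\<^sup>c\<close>, so its monomial is not in
  \<open>I(G\<^sup>c)\<close>, and the dual equals \<open>I(G\<^sup>c)\<close> iff there are no triangles. As \<open>G\<close> is not complete, some
  \<open>P\<^sub>F\<close> with two variables always occurs, so \<open>I\<^sub>c(G)\<close> is unmixed iff no \<open>P\<^sub>F\<close> with three variables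
  does.

  The last step needs that \<open>P\<^sub>F\<close> has height \<open>2\<close> for \<open>card F = 2\<close> and at least \<open>3\<close> for
  \<open>card F = 3\<close>. The lower bound comes from adding the variables one at a time. The upper bound is
  Krull's height theorem in a special case, for which there is an elementary proof: if a prime
  \<open>Q \<subseteq> (x\<^sub>a, x\<^sub>b)\<close> properly contains a nonzero prime, then \<open>x\<^sub>a \<in> Q\<close> (lemma
  \<open>variable_in_top_of_chain\<close>) and likewise \<open>x\<^sub>b \<in> Q\<close>, hence \<open>Q = (x\<^sub>a, x\<^sub>b)\<close>. It rests on the
  fact that in a polynomial ring \<open>D[y]\<close> over a domain no nonzero prime lies properly inside a
  prime that meets \<open>D\<close> in zero (lemma \<open>primes_over_zero_incomparable\<close>).
\<close>

section \<open>Polynomials with restricted supports\<close>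

abbreviation monomials :: "('k::field) mpoly \<Rightarrow> (nat \<Rightarrow>\<^sub>0 nat) set" where
  "monomials \<equiv> Poly_Mapping.keys"

abbreviation vars :: "(nat \<Rightarrow>\<^sub>0 nat) \<Rightarrow> nat set" where
  "vars \<equiv> Poly_Mapping.keys"

lemma vars_add: "vars (u + v) = vars u \<union> vars v"
  by (auto simp: in_keys_iff lookup_add)

text \<open>
  Besides the ring \<open>poly_ring n\<close> itself, the subrings omitting some of its variables occur below:
  as complements of monomial primes and as coefficient rings \<open>D\<close> when the ring is viewed as \<open>D[y]\<close>.
\<close>

definition polys_in :: "nat set \<Rightarrow> ('k::field) mpoly set" where
  "polys_in V = {p. \<forall>m\<in>monomials p. vars m \<subseteq> V}"

lemma carrier_poly_ring [simp]: "carrier (poly_ring n) = polys_in {1..n}"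
  by (simp add: poly_ring_def polys_in_def)

lemma poly_ring_ops [simp]:
  "x \<oplus>\<^bsub>poly_ring n\<^esub> y = x + y" "x \<otimes>\<^bsub>poly_ring n\<^esub> y = x * y"
  "\<zero>\<^bsub>poly_ring n\<^esub> = 0" "\<one>\<^bsub>poly_ring n\<^esub> = 1"
  by (simp_all add: poly_ring_def)

lemma polys_in_zero [simp]: "0 \<in> polys_in V"
  and polys_in_one [simp]: "1 \<in> polys_in V"
  by (simp_all add: polys_in_def)

lemma polys_in_add: "p \<in> polys_in V \<Longrightarrow> q \<in> polys_in V \<Longrightarrow> p + q \<in> polys_in V"
  using Poly_Mapping.keys_add[of p q] by (auto simp: polys_in_def)

lemma polys_in_uminus: "p \<in> polys_in V \<Longrightarrow> - p \<in> polys_in V"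
  by (simp add: polys_in_def)

lemma polys_in_diff: "p \<in> polys_in V \<Longrightarrow> q \<in> polys_in V \<Longrightarrow> p - q \<in> polys_in V"
  using polys_in_add[of p V "- q"] polys_in_uminus[of q V] by simp

lemma polys_in_mult:
  assumes "p \<in> polys_in V" "q \<in> polys_in V" shows "p * q \<in> polys_in V"
  unfolding polys_in_def
proof (intro CollectI ballI)
  fix m assume "m \<in> monomials (p * q)"
  then obtain a b where "m = a + b" "a \<in> monomials p" "b \<in> monomials q"
    using keys_mult[of p q] by blast
  then show "vars m \<subseteq> V" using assms by (auto simp: polys_in_def vars_add)
qed

lemma polys_in_single: "vars m \<subseteq> V \<Longrightarrow> Poly_Mapping.single m c \<in> polys_in V"
  by (simp add: polys_in_def)

lemma X_in_polys_in: "i \<in> V \<Longrightarrow> X i \<in> polys_in V"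
  by (simp add: X_def polys_in_single)

lemma polys_in_mono: "V \<subseteq> W \<Longrightarrow> polys_in V \<subseteq> polys_in W"
  by (auto simp: polys_in_def)

lemma sum_of_terms: "p = (\<Sum>m\<in>monomials p. Poly_Mapping.single m (Poly_Mapping.lookup p m))"
  by (rule poly_mapping_eqI) (simp add: lookup_sum lookup_single when_def in_keys_iff)

text \<open>
  This lemma and the next translate ideals of the record \<open>poly_ring n\<close> to the type-class
  operations on polynomials, in which all computations below are done.
\<close>

lemma ideal_poly_ringI:
  fixes J :: "('k::field) mpoly set"
  assumes sub: "J \<subseteq> polys_in {1..n}" and zero: "0 \<in> J"
    and add: "\<And>p q. p \<in> J \<Longrightarrow> q \<in> J \<Longrightarrow> p + q \<in> J"
    and mult: "\<And>p q. p \<in> polys_in {1..n} \<Longrightarrow> q \<in> J \<Longrightarrow> p * q \<in> J"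
  shows "ideal J (poly_ring n)"
proof -
  interpret cring "poly_ring n :: 'k mpoly ring" by (rule poly_ring_cring)
  have inv: "\<ominus>\<^bsub>poly_ring n\<^esub> p \<in> J" if "p \<in> J" for p
  proof -
    have p: "p \<in> carrier (poly_ring n)" using that sub by auto
    have "- p \<in> J" using mult[of "- 1" p] that polys_in_uminus[of 1 "{1..n}"] by simp
    moreover have "\<ominus>\<^bsub>poly_ring n\<^esub> p = - p"
      using p polys_in_uminus[of p "{1..n}"] by (intro minus_equality) auto
    ultimately show ?thesis by simp
  qed
  show ?thesis
  proof (rule idealI)
    show "ring (poly_ring n :: 'k mpoly ring)" by (rule ring_axioms)
    show "subgroup J (add_monoid (poly_ring n))"
      using sub zero add inv by (intro add.subgroupI) (auto simp: a_inv_def)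
    fix a x :: "'k mpoly" assume "a \<in> J" "x \<in> carrier (poly_ring n)"
    then have "x * a \<in> J" using mult by simp
    then show "x \<otimes>\<^bsub>poly_ring n\<^esub> a \<in> J" "a \<otimes>\<^bsub>poly_ring n\<^esub> x \<in> J"
      by (simp_all add: mult.commute)
  qed
qed

lemma ideal_poly_ringD:
  fixes J :: "('k::field) mpoly set"
  assumes "ideal J (poly_ring n)"
  shows "J \<subseteq> polys_in {1..n}" and "0 \<in> J"
    and "\<And>p q. p \<in> J \<Longrightarrow> q \<in> J \<Longrightarrow> p + q \<in> J"
    and "\<And>p q. p \<in> polys_in {1..n} \<Longrightarrow> q \<in> J \<Longrightarrow> p * q \<in> J"
    and "\<And>p q. p \<in> J \<Longrightarrow> q \<in> J \<Longrightarrow> p - q \<in> J"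
proof -
  interpret ideal J "poly_ring n" by (rule assms)
  show sub: "J \<subseteq> polys_in {1..n}" using a_subset by simp
  show "0 \<in> J" using additive_subgroup.zero_closed[OF additive_subgroup_axioms] by simp
  show add: "p + q \<in> J" if "p \<in> J" "q \<in> J" for p q
    using additive_subgroup.a_closed[OF additive_subgroup_axioms that] by simp
  show mult: "p * q \<in> J" if "p \<in> polys_in {1..n}" "q \<in> J" for p q
    using I_l_closed[of q p] that by simp
  show "p - q \<in> J" if "p \<in> J" "q \<in> J" for p q
    using add[OF that(1) mult[of "- 1" q]] that polys_in_uminus[of 1 "{1..n}"] by simp
qed

lemma primeideal_poly_ringD:
  fixes J :: "('k::field) mpoly set"
  assumes "primeideal J (poly_ring n)" "p \<in> polys_in {1..n}" "q \<in> polys_in {1..n}" "p * q \<in> J"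
  shows "p \<in> J \<or> q \<in> J"
  using primeideal.I_prime[OF assms(1)] assms(2-) by simp

section \<open>Squarefree monomial ideals\<close>

definition squarefree_ideal :: "nat \<Rightarrow> nat set set \<Rightarrow> ('k::field) mpoly set" where
  "squarefree_ideal n \<A> = {p \<in> polys_in {1..n}. \<forall>m\<in>monomials p. \<exists>A\<in>\<A>. A \<subseteq> vars m}"

definition indicator_exponent :: "nat set \<Rightarrow> nat \<Rightarrow>\<^sub>0 nat" where
  "indicator_exponent A = (\<Sum>j\<in>A. Poly_Mapping.single j 1)"

lemma lookup_indicator_exponent:
  "finite A \<Longrightarrow> Poly_Mapping.lookup (indicator_exponent A) i = (if i \<in> A then 1 else 0)"
  by (simp add: indicator_exponent_def lookup_sum lookup_single when_def)

lemma vars_indicator_exponent: "finite A \<Longrightarrow> vars (indicator_exponent A) = A"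
  by (auto simp: in_keys_iff lookup_indicator_exponent split: if_splits)

lemma prod_X: "finite A \<Longrightarrow> (\<Prod>j\<in>A. X j) = Poly_Mapping.single (indicator_exponent A) (1::'k::field)"
proof (induction A rule: finite_induct)
  case (insert j A)
  then show ?case by (simp add: X_def mult_single indicator_exponent_def)
qed (simp add: indicator_exponent_def)

lemma subset_vars_imp_multiple:
  assumes "finite A" "A \<subseteq> vars m"
  obtains v where "m = v + indicator_exponent A"
proof
  show "m = (m - indicator_exponent A) + indicator_exponent A"
    using assms by (intro poly_mapping_eqI)
      (auto simp: lookup_add lookup_minus lookup_indicator_exponent in_keys_iff subset_iff
        Suc_le_eq)
qed

lemma ideal_squarefree_ideal:
  "ideal (squarefree_ideal n \<A> :: ('k::field) mpoly set) (poly_ring n)"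
proof (rule ideal_poly_ringI)
  fix p q :: "'k mpoly"
  assume "p \<in> squarefree_ideal n \<A>" "q \<in> squarefree_ideal n \<A>"
  then show "p + q \<in> squarefree_ideal n \<A>"
    using Poly_Mapping.keys_add[of p q] by (auto simp: squarefree_ideal_def intro: polys_in_add)
next
  fix p q :: "'k mpoly"
  assume p: "p \<in> polys_in {1..n}" and q: "q \<in> squarefree_ideal n \<A>"
  have "\<exists>A\<in>\<A>. A \<subseteq> vars m" if mono: "m \<in> monomials (p * q)" for m
  proof -
    obtain a b where m: "m = a + b" and b: "b \<in> monomials q"
      using mono keys_mult[of p q] by blast
    from b obtain A where "A \<in> \<A>" "A \<subseteq> vars b" using q by (auto simp: squarefree_ideal_def)
    then show ?thesis by (auto simp: m vars_add)
  qed
  then show "p * q \<in> squarefree_ideal n \<A>"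
    using p q by (auto simp: squarefree_ideal_def intro: polys_in_mult)
qed (auto simp: squarefree_ideal_def)

text \<open>
  All ideals of the theorem are generated by squarefree monomials, and this membership criterion
  turns every question about them into one about sets of variables. A polynomial all of whose
  terms are multiples of generators is a sum of elements of the ideal; conversely, multiplying or
  adding polynomials of this kind creates only monomials of this kind.
\<close>

lemma Idl_squarefree:
  assumes "\<A> \<subseteq> Pow {1..n}"
  shows "Idl\<^bsub>poly_ring n\<^esub> ((\<lambda>A. \<Prod>j\<in>A. X j) ` \<A>) = (squarefree_ideal n \<A> :: ('k::field) mpoly set)"
    (is "?L = _")
proof
  interpret cring "poly_ring n :: 'k mpoly ring" by (rule poly_ring_cring)
  have fin: "finite A" if "A \<in> \<A>" for A
    using that assms finite_subset[of A "{1..n}"] by auto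
  have gen: "(\<Prod>j\<in>A. X j :: 'k mpoly) \<in> squarefree_ideal n \<A>" if "A \<in> \<A>" for A
  proof -
    have "A \<subseteq> {1..n}" using that assms by auto
    then show ?thesis using that fin[OF that]
      by (auto simp: prod_X squarefree_ideal_def vars_indicator_exponent intro!: polys_in_single)
  qed
  show "?L \<subseteq> squarefree_ideal n \<A>"
    by (rule genideal_minimal[OF ideal_squarefree_ideal]) (use gen in auto)
  have gens: "((\<lambda>A. \<Prod>j\<in>A. X j :: 'k mpoly) ` \<A>) \<subseteq> carrier (poly_ring n)"
    using gen by (auto simp: squarefree_ideal_def)
  note L = ideal_poly_ringD[OF genideal_ideal[OF gens]]
  show "squarefree_ideal n \<A> \<subseteq> ?L"
  proof
    fix p :: "'k mpoly" assume p: "p \<in> squarefree_ideal n \<A>"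
    have "Poly_Mapping.single m c \<in> ?L" if m: "m \<in> monomials p" for m c
    proof -
      obtain A where A: "A \<in> \<A>" "A \<subseteq> vars m" using p m by (auto simp: squarefree_ideal_def)
      then obtain v where v: "m = v + indicator_exponent A"
        using subset_vars_imp_multiple fin by blast
      have "vars m \<subseteq> {1..n}" using p that by (auto simp: squarefree_ideal_def polys_in_def)
      then have "Poly_Mapping.single v c \<in> polys_in {1..n}"
        by (intro polys_in_single) (simp add: v vars_add)
      moreover have "(\<Prod>j\<in>A. X j) \<in> ?L" using genideal_self[OF gens] A by blast
      ultimately have "Poly_Mapping.single v c * (\<Prod>j\<in>A. X j) \<in> ?L" by (rule L(4))
      then show ?thesis by (simp add: prod_X[OF fin[OF A(1)]] mult_single v)
    qed
    moreover have "sum f M \<in> ?L" if "finite M" "\<forall>m\<in>M. f m \<in> ?L"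
      for M and f :: "(nat \<Rightarrow>\<^sub>0 nat) \<Rightarrow> 'k mpoly"
      using that by (induction M rule: finite_induct) (auto intro: L)
    ultimately show "p \<in> ?L" by (subst sum_of_terms) simp
  qed
qed

lemma prod_X_in_squarefree_ideal_iff:
  assumes "A \<subseteq> {1..n}"
  shows "(\<Prod>j\<in>A. X j :: ('k::field) mpoly) \<in> squarefree_ideal n \<A> \<longleftrightarrow> (\<exists>B\<in>\<A>. B \<subseteq> A)"
  using assms finite_subset[OF assms]
  by (simp add: prod_X squarefree_ideal_def vars_indicator_exponent polys_in_single)

lemma complementary_edge_ideal_eq:
  assumes "simple_graph n E"
  shows "complementary_edge_ideal n E = (squarefree_ideal n ((\<lambda>e. {1..n} - e) ` E) :: ('k::field) mpoly set)"
proof -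
  have "{\<Prod>k\<in>{1..n} - {i, j}. X k :: 'k mpoly | i j. {i, j} \<in> E}
      = (\<lambda>A. \<Prod>j\<in>A. X j) ` (\<lambda>e. {1..n} - e) ` E" (is "?L = ?R")
  proof
    show "?R \<subseteq> ?L"
    proof
      fix p assume "p \<in> ?R"
      then obtain e where e: "e \<in> E" "p = (\<Prod>k\<in>{1..n} - e. X k)" by auto
      then obtain i j where "e = {i, j}" using assms by (auto simp: simple_graph_def card_2_iff)
      then show "p \<in> ?L" using e by blast
    qed
  qed blast
  then show ?thesis unfolding complementary_edge_ideal_def by (simp only:) (rule Idl_squarefree, auto)
qed

lemma edge_ideal_eq:
  assumes "simple_graph n E"
  shows "edge_ideal n E = (squarefree_ideal n E :: ('k::field) mpoly set)"
proof -
  have "{X i * X j :: 'k mpoly | i j. {i, j} \<in> E} = (\<lambda>A. \<Prod>j\<in>A. X j) ` E" (is "?L = ?R")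
  proof
    have "X i * X j \<in> ?R" if "{i, j} \<in> E" for i j
    proof -
      have "card {i, j} = 2" using assms that by (auto simp: simple_graph_def)
      then have "i \<noteq> j" by auto
      then have "X i * X j = (\<Prod>j\<in>{i, j}. X j :: 'k mpoly)" by simp
      then show ?thesis using that by blast
    qed
    then show "?L \<subseteq> ?R" by blast
    show "?R \<subseteq> ?L"
    proof
      fix p assume "p \<in> ?R"
      then obtain e where e: "e \<in> E" "p = (\<Prod>k\<in>e. X k)" by auto
      then obtain i j where "e = {i, j}" "i \<noteq> j"
        using assms by (auto simp: simple_graph_def card_2_iff)
      then show "p \<in> ?L" using e by auto
    qed
  qed
  then show ?thesis unfolding edge_ideal_def
    by (simp only:) (rule Idl_squarefree, use assms in \<open>auto simp: simple_graph_def\<close>)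
qed

section \<open>Monomial primes\<close>

lemma monomial_prime_eq:
  assumes "F \<subseteq> {1..n}"
  shows "monomial_prime n F = {p \<in> polys_in {1..n}. \<forall>m\<in>monomials (p :: ('k::field) mpoly). F \<inter> vars m \<noteq> {}}"
proof -
  have "X ` F = (\<lambda>A. \<Prod>j\<in>A. X j :: 'k mpoly) ` (\<lambda>i. {i}) ` F" by (simp add: image_image)
  then have "monomial_prime n F = (squarefree_ideal n ((\<lambda>i. {i}) ` F) :: 'k mpoly set)"
    unfolding monomial_prime_def by (simp only:) (rule Idl_squarefree, use assms in auto)
  then show ?thesis by (auto simp: squarefree_ideal_def)
qed

lemma ideal_monomial_prime:
  "F \<subseteq> {1..n} \<Longrightarrow> ideal (monomial_prime n F :: ('k::field) mpoly set) (poly_ring n)"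
  unfolding monomial_prime_def
  by (intro ring.genideal_ideal cring.axioms(1) poly_ring_cring) (auto intro: X_in_polys_in)

text \<open>
  Setting the variables in \<open>F\<close> to zero retracts the ring onto the polynomials in the other
  variables with kernel \<open>P\<^sub>F\<close>; here \<open>r\<close> is the image of \<open>p\<close>. Primality of \<open>P\<^sub>F\<close> follows, as
  the image ring is a domain.
\<close>

lemma split_off_monomial_prime:
  fixes p :: "('k::field) mpoly"
  assumes F: "F \<subseteq> {1..n}" and p: "p \<in> polys_in {1..n}"
  obtains r where "r \<in> polys_in ({1..n} - F)" "p - r \<in> monomial_prime n F"
proof
  let ?term = "\<lambda>m. Poly_Mapping.single m (Poly_Mapping.lookup p m)"
  let ?r = "\<Sum>m | m \<in> monomials p \<and> F \<inter> vars m = {}. ?term m"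
  have look: "Poly_Mapping.lookup ?r m = (if F \<inter> vars m = {} then Poly_Mapping.lookup p m else 0)" for m
    by (simp add: lookup_sum lookup_single when_def in_keys_iff)
  show r: "?r \<in> polys_in ({1..n} - F)"
    unfolding polys_in_def
  proof (intro CollectI ballI)
    fix m assume "m \<in> monomials ?r"
    then have "F \<inter> vars m = {} \<and> m \<in> monomials p" using look[of m] in_keys_iff[of m ?r] in_keys_iff[of m p] by (simp split: if_splits)
    then show "vars m \<subseteq> {1..n} - F" using p unfolding polys_in_def by blast
  qed
  have "?r \<in> polys_in {1..n}" using r polys_in_mono[of "{1..n} - F" "{1..n}"] by auto
  then have "p - ?r \<in> polys_in {1..n}" using p by (intro polys_in_diff)
  moreover have "F \<inter> vars m \<noteq> {}" if "m \<in> monomials (p - ?r)" for m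
    using that look[of m] in_keys_iff[of m "p - ?r"] lookup_minus[of p ?r m] by (auto split: if_splits)
  ultimately show "p - ?r \<in> monomial_prime n F" unfolding monomial_prime_eq[OF F] by blast
qed

lemma polys_in_Int_monomial_prime:
  fixes p :: "('k::field) mpoly"
  assumes "F \<subseteq> {1..n}" "p \<in> polys_in ({1..n} - F)" "p \<in> monomial_prime n F"
  shows "p = 0"
proof -
  have "monomials p = {}" using assms by (fastforce simp: monomial_prime_eq polys_in_def)
  then show ?thesis by simp
qed

lemma primeideal_monomial_prime:
  assumes F: "F \<subseteq> {1..n}"
  shows "primeideal (monomial_prime n F :: ('k::field) mpoly set) (poly_ring n)"
proof (rule primeidealI[OF ideal_monomial_prime[OF F] poly_ring_cring])
  let ?P = "monomial_prime n F :: 'k mpoly set"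
  note P = ideal_poly_ringD[OF ideal_monomial_prime[OF F], where ?'k = 'k]
  have "1 \<notin> ?P" by (simp add: monomial_prime_eq[OF F])
  then show "carrier (poly_ring n) \<noteq> ?P" using polys_in_one by (metis carrier_poly_ring)
  fix a b :: "'k mpoly"
  assume "a \<in> carrier (poly_ring n)" "b \<in> carrier (poly_ring n)" "a \<otimes>\<^bsub>poly_ring n\<^esub> b \<in> ?P"
  then have a: "a \<in> polys_in {1..n}" and b: "b \<in> polys_in {1..n}" and ab: "a * b \<in> ?P" by auto
  obtain a' where a': "a' \<in> polys_in ({1..n} - F)" "a - a' \<in> ?P"
    using split_off_monomial_prime[OF F a] .
  obtain b' where b': "b' \<in> polys_in ({1..n} - F)" "b - b' \<in> ?P"
    using split_off_monomial_prime[OF F b] .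
  have sub: "polys_in ({1..n} - F) \<subseteq> (polys_in {1..n} :: 'k mpoly set)" by (intro polys_in_mono) auto
  have "b * (a - a') \<in> ?P" "a' * (b - b') \<in> ?P" using P(4) a' b' b sub by auto
  then have "a * b - (b * (a - a') + a' * (b - b')) \<in> ?P" using ab by (intro P(5) P(3))
  then have "a' * b' \<in> ?P" by (simp add: algebra_simps)
  then have "a' * b' = 0"
    using polys_in_Int_monomial_prime[OF F] polys_in_mult a'(1) b'(1) by blast
  then show "a \<in> ?P \<or> b \<in> ?P" using a' b' by auto
qed

lemma monomial_prime_subset_iff:
  assumes "F \<subseteq> {1..n}" "G \<subseteq> {1..n}"
  shows "(monomial_prime n F :: ('k::field) mpoly set) \<subseteq> monomial_prime n G \<longleftrightarrow> F \<subseteq> G"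
proof
  assume sub: "(monomial_prime n F :: 'k mpoly set) \<subseteq> monomial_prime n G"
  show "F \<subseteq> G"
  proof
    fix i assume i: "i \<in> F"
    then have "(X i :: 'k mpoly) \<in> monomial_prime n F"
      using assms X_in_polys_in[of i "{1..n}"] by (auto simp: monomial_prime_eq X_def)
    then show "i \<in> G" using sub assms by (auto simp: monomial_prime_eq X_def)
  qed
qed (unfold monomial_prime_eq[OF assms(1)] monomial_prime_eq[OF assms(2)], blast)

lemma inj_on_monomial_prime:
  "inj_on (monomial_prime n :: nat set \<Rightarrow> ('k::field) mpoly set) (Pow {1..n})"
proof (rule inj_onI)
  fix F G assume "F \<in> Pow {1..n}" "G \<in> Pow {1..n}"
    and "(monomial_prime n F :: 'k mpoly set) = monomial_prime n G"
  then show "F = G"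
    using monomial_prime_subset_iff[of F n G, where ?'k = 'k]
      monomial_prime_subset_iff[of G n F, where ?'k = 'k] by auto
qed

section \<open>Irredundant intersections of primes\<close>

lemma (in cring) ideal_prod_closed_in_Inter:
  assumes "\<And>P. P \<in> Ps \<Longrightarrow> ideal P R" "a \<in> carrier R \<inter> \<Inter>Ps" "b \<in> carrier R"
  shows "a \<otimes> b \<in> carrier R \<inter> \<Inter>Ps"
  using assms by (auto intro: ideal.I_r_closed)

text \<open>
  If no member of the family is contained in the prime, the product of elements outside the
  prime, one from each member, lies in the intersection but not in the prime.
\<close>

lemma (in primeideal) finite_Inter_subset:
  assumes "finite Ps" "\<And>P. P \<in> Ps \<Longrightarrow> ideal P R" "carrier R \<inter> \<Inter>Ps \<subseteq> I"
  shows "\<exists>P\<in>Ps. P \<subseteq> I"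
  using assms
proof (induction Ps rule: finite_induct)
  case empty
  then show ?case using I_notcarr a_subset by auto
next
  case (insert P Ps)
  show ?case
  proof (cases "P \<subseteq> I")
    case False
    then obtain a where a: "a \<in> P" "a \<notin> I" by auto
    interpret P: ideal P R using insert.prems by auto
    have "carrier R \<inter> \<Inter>Ps \<subseteq> I"
    proof
      fix b assume b: "b \<in> carrier R \<inter> \<Inter>Ps"
      have "b \<otimes> a \<in> carrier R \<inter> \<Inter>Ps"
        using ideal_prod_closed_in_Inter[of Ps b a] insert.prems b a P.a_subset by auto
      moreover have "b \<otimes> a \<in> P" using P.I_l_closed a b by auto
      ultimately have "b \<otimes> a \<in> I" using insert.prems by auto
      then show "b \<in> I" using I_prime[of b a] a b P.a_subset by auto
    qed
    then show ?thesis using insert by auto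
  qed auto
qed

definition irredundant_primes :: "('a, 'b) ring_scheme \<Rightarrow> 'a set set \<Rightarrow> bool" where
  "irredundant_primes R Ps \<longleftrightarrow> finite Ps \<and> (\<forall>P\<in>Ps. primeideal P R) \<and>
     (\<forall>P\<in>Ps. \<not> carrier R \<inter> \<Inter>(Ps - {P}) \<subseteq> P)"

text \<open>
  For an intersection \<open>I\<close> of primes, \<open>I : f\<close> is the intersection of those primes that do not
  contain \<open>f\<close>. If it is prime, it contains one of them and hence equals it. Conversely,
  irredundancy yields for each prime \<open>P\<close> of the family an \<open>f\<close> that avoids \<open>P\<close> only, and then
  \<open>I : f = P\<close>.
\<close>

lemma (in cring) associated_primes_Inter:
  assumes "irredundant_primes R Ps"
  shows "associated_primes R (carrier R \<inter> \<Inter>Ps) = Ps"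
proof
  let ?I = "carrier R \<inter> \<Inter>Ps"
  have fin: "finite Ps" and prime: "\<And>P. P \<in> Ps \<Longrightarrow> primeideal P R"
    and irr: "\<And>P. P \<in> Ps \<Longrightarrow> \<not> carrier R \<inter> \<Inter>(Ps - {P}) \<subseteq> P"
    using assms by (auto simp: irredundant_primes_def)
  have ideal: "\<And>P. P \<in> Ps \<Longrightarrow> ideal P R" using prime by (auto intro: primeideal.axioms(1))
  have colon: "{r \<in> carrier R. r \<otimes> f \<in> ?I} = carrier R \<inter> \<Inter>{P\<in>Ps. f \<notin> P}"
    if f: "f \<in> carrier R" for f
  proof -
    have "r \<otimes> f \<in> P \<longleftrightarrow> r \<in> P \<or> f \<in> P" if "r \<in> carrier R" "P \<in> Ps" for r P
      using primeideal.I_prime[OF prime[OF that(2)], of r f] that f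
        ideal.I_r_closed[OF ideal[OF that(2)], of r f] ideal.I_l_closed[OF ideal[OF that(2)], of f r]
      by auto
    then show ?thesis using f by auto
  qed
  show "associated_primes R ?I \<subseteq> Ps"
  proof
    fix P assume "P \<in> associated_primes R ?I"
    then obtain f where P: "primeideal P R" and f: "f \<in> carrier R"
      and eq: "P = carrier R \<inter> \<Inter>{P\<in>Ps. f \<notin> P}"
      using colon by (auto simp: associated_primes_def)
    then obtain Q where Q: "Q \<in> Ps" "f \<notin> Q" "Q \<subseteq> P"
      using primeideal.finite_Inter_subset[OF P, of "{P\<in>Ps. f \<notin> P}"] fin ideal by auto
    then have "P = Q" using eq by auto
    then show "P \<in> Ps" using Q by simp
  qed
  show "Ps \<subseteq> associated_primes R ?I"
  proof
    fix P assume P: "P \<in> Ps"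
    then obtain f where f: "f \<in> carrier R" "\<forall>Q\<in>Ps - {P}. f \<in> Q" "f \<notin> P"
      using irr by blast
    then have "{Q\<in>Ps. f \<notin> Q} = {P}" using P by auto
    moreover have "P \<subseteq> carrier R"
      by (rule additive_subgroup.a_subset[OF ideal.axioms(1)[OF ideal[OF P]]])
    ultimately have "P = {r \<in> carrier R. r \<otimes> f \<in> ?I}" using colon[OF f(1)] by auto
    then show "P \<in> associated_primes R ?I" using prime[OF P] f by (auto simp: associated_primes_def)
  qed
qed

lemma (in primeideal) radical_eq: "radical R I = I"
proof -
  have "r \<in> I" if "r \<in> carrier R" "r [^] (k::nat) \<in> I" for r k
    using that(2)
  proof (induction k)
    case 0
    then show ?case using I_notcarr one_imp_carrier by auto
  next
    case (Suc k)
    then show ?case using I_prime[of "r [^] k" r] that by auto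
  qed
  moreover have "r [^] (1::nat) \<in> I" if "r \<in> I" for r using that a_subset by auto
  ultimately show ?thesis unfolding radical_def using a_subset by blast
qed

lemma (in primeideal) primary: "primary_ideal R I"
  unfolding primary_ideal_def radical_eq using is_ideal I_notcarr I_prime by auto

text \<open>
  Primes are primary and equal to their radicals, so for families of primes the conditions
  specific to primary ideals hold automatically.
\<close>

lemma (in cring) minimal_primary_decomposition_iff_irredundant_primes:
  assumes "\<And>P. P \<in> Ps \<Longrightarrow> primeideal P R"
  shows "minimal_primary_decomposition R I Ps \<longleftrightarrow>
    irredundant_primes R Ps \<and> I = carrier R \<inter> \<Inter>Ps"
proof -
  have "inj_on (radical R) Ps"
    using assms by (auto intro!: inj_onI simp: primeideal.radical_eq)
  then show ?thesis
    using assms primeideal.primary[OF assms]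
    by (auto simp: minimal_primary_decomposition_def irredundant_primes_def)
qed

section \<open>Heights of monomial primes\<close>

text \<open>
  Adding the variables of \<open>F\<close> one at a time, starting from the zero ideal, gives a chain of
  monomial primes of length \<open>card F\<close>.
\<close>

lemma card_le_height_monomial_prime:
  assumes F: "F \<subseteq> {1..n}"
  shows "enat (card F) \<le> height (poly_ring n) (monomial_prime n F :: ('k::field) mpoly set)"
proof -
  obtain xs where xs: "set xs = F" "distinct xs"
    using finite_distinct_list finite_subset[OF F] by blast
  let ?Q = "\<lambda>i. monomial_prime n (set (take i xs)) :: 'k mpoly set"
  have sub: "set (take i xs) \<subseteq> {1..n}" for i using F xs(1) set_take_subset[of i xs] by auto
  have "?Q i \<subset> ?Q (Suc i)" if "i < length xs" for i
  proof -
    have "xs ! i \<notin> set (take i xs)"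
      using that xs(2) by (auto simp: in_set_conv_nth nth_eq_iff_index_eq)
    then have "set (take i xs) \<subset> set (take (Suc i) xs)"
      using that by (auto simp: take_Suc_conv_app_nth)
    then show ?thesis
      using monomial_prime_subset_iff[OF sub sub, where ?'k = 'k] by (simp add: less_le_not_le)
  qed
  then have "\<exists>Q :: nat \<Rightarrow> 'k mpoly set. (\<forall>i\<le>length xs. primeideal (Q i) (poly_ring n)) \<and>
      (\<forall>i<length xs. Q i \<subset> Q (Suc i)) \<and> Q (length xs) = monomial_prime n F"
    using primeideal_monomial_prime[OF sub] xs(1) by (intro exI[of _ ?Q]) auto
  then show ?thesis
    unfolding height_def using distinct_card[OF xs(2)] xs(1) by (intro Sup_upper) auto
qed

definition polys_over :: "'a::idom set \<Rightarrow> 'a poly set" where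
  "polys_over D = {p. \<forall>i. coeff p i \<in> D}"

text \<open>
  Division with remainder works over any domain once the dividend may be scaled by a power of the
  leading coefficient of the divisor. The coefficients are confined to a subring \<open>D\<close> because \<open>D\<close>
  will be a ring of polynomials that omit one variable, which is not a type of its own.
\<close>

lemma pseudo_division_over:
  fixes D :: "'a::idom set"
  assumes D: "0 \<in> D" "1 \<in> D" "\<And>a b. a \<in> D \<Longrightarrow> b \<in> D \<Longrightarrow> a + b \<in> D"
      "\<And>a b. a \<in> D \<Longrightarrow> b \<in> D \<Longrightarrow> a - b \<in> D" "\<And>a b. a \<in> D \<Longrightarrow> b \<in> D \<Longrightarrow> a * b \<in> D"
    and g: "g \<in> polys_over D" "g \<noteq> 0"
    and f: "f \<in> polys_over D"
  shows "\<exists>c q r. c \<in> D \<and> c \<noteq> 0 \<and> q \<in> polys_over D \<and> r \<in> polys_over D \<and>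
    smult c f = q * g + r \<and> (r = 0 \<or> degree r < degree g)"
  using f
proof (induction "degree f" arbitrary: f rule: less_induct)
  case less
  have smultD: "smult c p \<in> polys_over D" if "c \<in> D" "p \<in> polys_over D" for c p
    using that D by (auto simp: polys_over_def)
  have addD: "p + q \<in> polys_over D" if "q \<in> polys_over D" "p \<in> polys_over D" for p q
    using that D by (auto simp: polys_over_def)
  have monomD: "monom c k \<in> polys_over D" if "c \<in> D" for c k
    using that D by (auto simp: polys_over_def)
  have zeroD: "0 \<in> polys_over D" using D by (auto simp: polys_over_def)
  show ?case
  proof (cases "f = 0 \<or> degree f < degree g")
    case True
    then show ?thesis
      using less.prems D zeroD by (intro exI[of _ 1] exI[of _ 0] exI[of _ f]) auto
  next
    case False
    let ?k = "degree f - degree g"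
    let ?t = "monom (lead_coeff f) ?k"
    \<comment> \<open>The leading terms of the two summands cancel.\<close>
    let ?f' = "smult (lead_coeff g) f - ?t * g"
    have lc: "lead_coeff f \<in> D" "lead_coeff g \<in> D" "lead_coeff g \<noteq> 0"
      using less.prems g by (auto simp: polys_over_def)
    have f'D: "?f' \<in> polys_over D"
      using less.prems g D lc by (auto simp: polys_over_def coeff_monom_mult)
    have "degree ?f' \<le> degree f"
    proof (rule degree_diff_le)
      show "degree (?t * g) \<le> degree f"
        using False degree_mult_le[of ?t g] degree_monom_le[of "lead_coeff f" ?k] by linarith
    qed (rule degree_smult_le)
    moreover have "coeff ?f' (degree f) = 0" using False by (simp add: coeff_monom_mult)
    ultimately have "?f' = 0 \<or> degree ?f' < degree f" by (rule eq_zero_or_degree_less)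
    then show ?thesis
    proof
      assume "?f' = 0"
      then show ?thesis
        using lc monomD zeroD
        by (intro exI[of _ "lead_coeff g"] exI[of _ ?t] exI[of _ 0]) auto
    next
      assume "degree ?f' < degree f"
      from less.hyps[OF this f'D] obtain c q r where
        cqr: "c \<in> D" "c \<noteq> 0" "q \<in> polys_over D" "r \<in> polys_over D"
        "smult c ?f' = q * g + r" "r = 0 \<or> degree r < degree g" by auto
      have "smult (c * lead_coeff g) f = smult c ?f' + smult c ?t * g"
        by (simp add: smult_diff_right)
      also have "\<dots> = (q + smult c ?t) * g + r"
        unfolding cqr(5) by (simp add: algebra_simps)
      finally have eq: "smult (c * lead_coeff g) f = (q + smult c ?t) * g + r" .
      show ?thesis
        by (intro exI[of _ "c * lead_coeff g"] exI[of _ "q + smult c ?t"] exI[of _ r] conjI)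
          (use eq cqr lc in \<open>auto intro: addD smultD monomD D\<close>)
    qed
  qed
qed

text \<open>
  The next two lemmas present the polynomials in the variables \<open>V\<close> as values at \<open>y = x\<^sub>b\<close> of
  univariate polynomials with coefficients free of \<open>x\<^sub>b\<close>. Uniqueness of this presentation is never
  used: ideals are pulled back along evaluation, and degrees are only compared upstairs.
\<close>

lemma poly_in_polys_in:
  fixes P :: "('k::field) mpoly poly"
  assumes b: "b \<in> V" and P: "P \<in> polys_over (polys_in V)"
  shows "poly P (X b) \<in> polys_in V"
proof -
  have "poly p (X b) \<in> polys_in V" if "set (coeffs p) \<subseteq> polys_in V" for p :: "'k mpoly poly"
    using that by (induction p)
      (auto simp: cCons_def split: if_splits intro!: polys_in_add polys_in_mult X_in_polys_in b)
  moreover have "set (coeffs P) \<subseteq> polys_in V"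
    using P by (auto simp: polys_over_def coeffs_def)
  ultimately show ?thesis by blast
qed

lemma ex_poly_in_X:
  fixes f :: "('k::field) mpoly"
  assumes "f \<in> polys_in V"
  shows "\<exists>P\<in>polys_over (polys_in (V - {b})). poly P (X b) = f"
proof -
  let ?D = "polys_in (V - {b}) :: 'k mpoly set"
  have X_pow: "X b ^ k = Poly_Mapping.single (Poly_Mapping.single b k) (1::'k)" for k
    by (induction k) (simp_all add: X_def mult_single flip: single_add)
  have single_term: "\<exists>P\<in>polys_over ?D. poly P (X b) = Poly_Mapping.single m c"
    if m: "vars m \<subseteq> V" for m and c :: 'k
  proof -
    let ?k = "Poly_Mapping.lookup m b"
    let ?m = "m - Poly_Mapping.single b ?k"
    have m': "m = ?m + Poly_Mapping.single b ?k"
      by (rule poly_mapping_eqI) (auto simp: lookup_add lookup_minus lookup_single when_def)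
    have "vars ?m \<subseteq> V - {b}"
      using m by (auto simp: in_keys_iff lookup_minus lookup_single when_def split: if_splits)
    then have "monom (Poly_Mapping.single ?m c) ?k \<in> polys_over ?D"
      by (auto simp: polys_over_def intro: polys_in_single)
    moreover have "poly (monom (Poly_Mapping.single ?m c) ?k) (X b) = Poly_Mapping.single m c"
      using m' by (simp add: poly_monom X_pow mult_single)
    ultimately show ?thesis by blast
  qed
  have sum: "\<exists>P\<in>polys_over ?D. poly P (X b) = (\<Sum>m\<in>M. Poly_Mapping.single m (c m))"
    if "finite M" "\<forall>m\<in>M. vars m \<subseteq> V" for M and c :: "_ \<Rightarrow> 'k"
    using that
  proof (induction M rule: finite_induct)
    case empty
    then show ?case by (intro bexI[of _ 0]) (auto simp: polys_over_def)
  next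
    case (insert m M)
    then obtain P Q where "P \<in> polys_over ?D" "poly P (X b) = Poly_Mapping.single m (c m)"
      "Q \<in> polys_over ?D" "poly Q (X b) = (\<Sum>m\<in>M. Poly_Mapping.single m (c m))"
      using single_term[of m "c m"] by auto
    then show ?case using insert
      by (intro bexI[of _ "P + Q"]) (auto simp: polys_over_def intro: polys_in_add)
  qed
  show ?thesis
    using sum[of "monomials f" "Poly_Mapping.lookup f"] assms sum_of_terms[of f]
    by (auto simp: polys_in_def)
qed

text \<open>
  Write the ring as \<open>D[y]\<close> with \<open>y = x\<^sub>b\<close>, and let \<open>f\<close> and \<open>g\<close> be nonzero elements of minimal degree in
  \<open>Q\<^sub>1\<close> and \<open>Q\<^sub>2\<close>. As \<open>Q\<^sub>2\<close> meets \<open>D\<close> in zero, \<open>g\<close> has positive degree, and pseudo-division shows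
  that each element of \<open>Q\<^sub>2\<close> has a nonzero \<open>D\<close>-multiple that is divisible by \<open>g\<close>. In particular
  \<open>c f = q g\<close>, where \<open>q\<close> has smaller degree than \<open>f\<close> and thus is not in \<open>Q\<^sub>1\<close>. Primality gives
  \<open>g \<in> Q\<^sub>1\<close>. Now every \<open>p \<in> Q\<^sub>2\<close> has a multiple \<open>c p \<in> Q\<^sub>1\<close> with \<open>c\<close> outside \<open>Q\<^sub>1\<close>, so
  \<open>p \<in> Q\<^sub>1\<close>.
\<close>

lemma primes_over_zero_incomparable:
  fixes Q\<^sub>1 Q\<^sub>2 :: "('k::field) mpoly set"
  assumes b: "b \<in> {1..n}"
    and Q1: "primeideal Q\<^sub>1 (poly_ring n)" and Q2: "primeideal Q\<^sub>2 (poly_ring n)"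
    and sub: "Q\<^sub>1 \<subseteq> Q\<^sub>2" and nonzero: "Q\<^sub>1 \<noteq> {0}"
    and contract: "Q\<^sub>2 \<inter> polys_in ({1..n} - {b}) \<subseteq> {0}"
  shows "Q\<^sub>1 = Q\<^sub>2"
proof -
  let ?D = "polys_in ({1..n} - {b}) :: 'k mpoly set"
  let ?ev = "\<lambda>P. poly P (X b) :: 'k mpoly"
  note I1 = ideal_poly_ringD[OF primeideal.axioms(1)[OF Q1]]
  note I2 = ideal_poly_ringD[OF primeideal.axioms(1)[OF Q2]]
  have D: "?D \<subseteq> polys_in {1..n}" by (rule polys_in_mono) auto
  have ev: "?ev P \<in> polys_in {1..n}" if "P \<in> polys_over ?D" for P
    by (rule poly_in_polys_in[OF b]) (use that D in \<open>auto simp: polys_over_def\<close>)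
  have division: "\<exists>c q r. c \<in> ?D \<and> c \<noteq> 0 \<and> q \<in> polys_over ?D \<and> r \<in> polys_over ?D \<and>
      smult c P = q * G + r \<and> (r = 0 \<or> degree r < degree G)"
    if "G \<in> polys_over ?D" "G \<noteq> 0" "P \<in> polys_over ?D" for G P
    using that by (intro pseudo_division_over polys_in_zero polys_in_one polys_in_add polys_in_diff polys_in_mult)
  obtain h where h: "h \<in> Q\<^sub>1" "h \<noteq> 0" using nonzero I1(2) by blast
  obtain H where H: "H \<in> polys_over ?D" "?ev H = h" using ex_poly_in_X[of h "{1..n}" b] h I1(1) by auto
  define S\<^sub>1 where "S\<^sub>1 = {P \<in> polys_over ?D. P \<noteq> 0 \<and> ?ev P \<in> Q\<^sub>1}"
  define S\<^sub>2 where "S\<^sub>2 = {P \<in> polys_over ?D. P \<noteq> 0 \<and> ?ev P \<in> Q\<^sub>2}"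
  have H': "H \<in> S\<^sub>1" using H h by (auto simp: S\<^sub>1_def)
  then have H'': "H \<in> S\<^sub>2" using sub by (auto simp: S\<^sub>1_def S\<^sub>2_def)
  define f where "f = arg_min degree (\<lambda>P. P \<in> S\<^sub>1)"
  define g where "g = arg_min degree (\<lambda>P. P \<in> S\<^sub>2)"
  have f: "f \<in> S\<^sub>1" "\<And>P. P \<in> S\<^sub>1 \<Longrightarrow> degree f \<le> degree P"
    unfolding f_def using H' by (auto intro: arg_min_natI arg_min_nat_le)
  have g: "g \<in> S\<^sub>2" "\<And>P. P \<in> S\<^sub>2 \<Longrightarrow> degree g \<le> degree P"
    unfolding g_def using H'' by (auto intro: arg_min_natI arg_min_nat_le)
  have gD: "g \<in> polys_over ?D" "g \<noteq> 0" "?ev g \<in> Q\<^sub>2" using g(1) by (auto simp: S\<^sub>2_def)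
  have fD: "f \<in> polys_over ?D" "f \<noteq> 0" "?ev f \<in> Q\<^sub>1" using f(1) by (auto simp: S\<^sub>1_def)
  have deg_g: "degree g > 0"
  proof (rule ccontr)
    assume "\<not> degree g > 0"
    then have "degree g = 0" by simp
    then obtain c where c: "g = [:c:]" by (rule degree_eq_zeroE)
    have "coeff g 0 \<in> ?D" using gD(1) unfolding polys_over_def by blast
    then have "c \<in> ?D" unfolding c by simp
    moreover have "c \<in> Q\<^sub>2" "c \<noteq> 0" using gD(2,3) unfolding c by simp_all
    ultimately show False using contract by blast
  qed
  have multiple: "\<exists>c q. c \<in> ?D \<and> c \<noteq> 0 \<and> q \<in> polys_over ?D \<and> smult c P = q * g"
    if P: "P \<in> polys_over ?D" "?ev P \<in> Q\<^sub>2" for P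
  proof -
    obtain c q r where cqr: "c \<in> ?D" "c \<noteq> 0" "q \<in> polys_over ?D" "r \<in> polys_over ?D"
      "smult c P = q * g + r" "r = 0 \<or> degree r < degree g"
      using division[OF gD(1,2) P(1)] by blast
    have "?ev r = c * ?ev P - ?ev q * ?ev g" using arg_cong[OF cqr(5), of ?ev] by simp
    then have "?ev r \<in> Q\<^sub>2" using I2(4,5) P gD cqr(1) ev[OF cqr(3)] D by auto
    then have "r = 0" using g(2)[of r] cqr(4,6) unfolding S\<^sub>2_def by fastforce
    then show ?thesis using cqr by auto
  qed
  obtain c q where cq: "c \<in> ?D" "c \<noteq> 0" "q \<in> polys_over ?D" "smult c f = q * g"
    using multiple[of f] fD sub by blast
  have "?ev q * ?ev g \<in> Q\<^sub>1"
    using arg_cong[OF cq(4), of ?ev] I1(4)[of c "?ev f"] cq(1) D fD by auto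
  then have "?ev q \<in> Q\<^sub>1 \<or> ?ev g \<in> Q\<^sub>1"
    using primeideal_poly_ringD[OF Q1] ev cq(3) gD(1) by blast
  moreover have "?ev q \<notin> Q\<^sub>1"
  proof
    assume "?ev q \<in> Q\<^sub>1"
    moreover have "q \<noteq> 0" using cq fD by auto
    ultimately have "degree f \<le> degree q" using f(2) cq(3) by (auto simp: S\<^sub>1_def)
    moreover have "degree f = degree q + degree g"
      using arg_cong[OF cq(4), of degree] cq(2) \<open>q \<noteq> 0\<close> gD(2) by (simp add: degree_mult_eq)
    ultimately show False using deg_g by simp
  qed
  ultimately have g1: "?ev g \<in> Q\<^sub>1" by simp
  have "p \<in> Q\<^sub>1" if p: "p \<in> Q\<^sub>2" for p
  proof -
    obtain P where P: "P \<in> polys_over ?D" "?ev P = p"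
      using ex_poly_in_X[of p "{1..n}" b] p I2(1) by auto
    then obtain c q where cq: "c \<in> ?D" "c \<noteq> 0" "q \<in> polys_over ?D" "smult c P = q * g"
      using multiple p by blast
    have "c * p \<in> Q\<^sub>1"
      using arg_cong[OF cq(4), of ?ev] I1(4)[OF ev[OF cq(3)] g1] P by simp
    moreover have "c \<notin> Q\<^sub>1" using sub contract cq by auto
    ultimately show ?thesis using primeideal_poly_ringD[OF Q1, of c p] cq(1) D p I2(1) by blast
  qed
  then show ?thesis using sub by auto
qed

text \<open>
  A nonzero \<open>h \<in> Q\<close> free of \<open>x\<^sub>b\<close> is a multiple of \<open>x\<^sub>a\<close>, because \<open>Q \<subseteq> (x\<^sub>a, x\<^sub>b)\<close>. If
  \<open>x\<^sub>a \<notin> Q\<close>, the cofactor \<open>h / x\<^sub>a\<close> is again such an element, and dividing by \<open>x\<^sub>a\<close> would never end.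
  So \<open>x\<^sub>a \<notin> Q\<close> forces \<open>Q\<close> to meet the polynomials free of \<open>x\<^sub>b\<close> in zero, which is impossible
  as \<open>Q\<close> properly contains a nonzero prime.
\<close>

lemma variable_in_top_of_chain:
  fixes Q :: "('k::field) mpoly set"
  assumes ab: "a \<in> {1..n}" "b \<in> {1..n}"
    and Q1: "primeideal Q\<^sub>1 (poly_ring n)" and Q: "primeideal Q (poly_ring n)"
    and chain: "Q\<^sub>1 \<noteq> {0}" "Q\<^sub>1 \<subset> Q" "Q \<subseteq> monomial_prime n {a, b}"
  shows "X a \<in> Q"
proof (rule ccontr)
  assume a: "X a \<notin> Q"
  note I = ideal_poly_ringD[OF primeideal.axioms(1)[OF Q]]
  let ?D = "polys_in ({1..n} - {b}) :: 'k mpoly set"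
  have D: "?D \<subseteq> polys_in {1..n}" by (rule polys_in_mono) auto
  have False if "h \<in> Q" "h \<in> ?D" "m \<in> monomials h" for h m
    using that
  proof (induction "Poly_Mapping.lookup m a" arbitrary: h m rule: less_induct)
    case less
    obtain c where c: "c \<in> ?D" "h = X a * c"
    proof -
      have "{a, b} \<subseteq> {1..n}" using ab by simp
      note P = monomial_prime_eq[OF this, where ?'k = 'k]
      have h: "h \<in> monomial_prime n {a, b}" using less.prems(1) chain(3) by blast
      have all: "a \<in> vars m" "vars m \<subseteq> {1..n} - {b}" if "m \<in> monomials h" for m
      proof -
        show "vars m \<subseteq> {1..n} - {b}" using less.prems(2) that unfolding polys_in_def by blast
        then show "a \<in> vars m" using h that unfolding P by blast
      qed
      let ?e = "Poly_Mapping.single a (1::nat)"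
      have eq: "?e + (m - ?e) = m" if "m \<in> monomials h" for m
        using all(1)[OF that] unfolding in_keys_iff
        by (intro poly_mapping_eqI) (auto simp: lookup_add lookup_minus lookup_single when_def)
      let ?c = "\<Sum>m\<in>monomials h. Poly_Mapping.single (m - ?e) (Poly_Mapping.lookup h m)"
      have "X a * ?c = (\<Sum>m\<in>monomials h. Poly_Mapping.single m (Poly_Mapping.lookup h m))"
        unfolding sum_distrib_left by (intro sum.cong refl) (simp add: X_def mult_single eq del: One_nat_def)
      then have "h = X a * ?c" using sum_of_terms[of h] by simp
      moreover have "?c \<in> ?D"
      proof -
        have "vars (m - ?e) \<subseteq> vars m" for m by (auto simp: in_keys_iff lookup_minus)
        then have "Poly_Mapping.single (m - ?e) (Poly_Mapping.lookup h m) \<in> ?D" if "m \<in> monomials h" for m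
          using all[OF that] by (intro polys_in_single) blast
        moreover have "sum t M \<in> ?D" if "finite M" "\<forall>m\<in>M. t m \<in> ?D"
          for M and t :: "(nat \<Rightarrow>\<^sub>0 nat) \<Rightarrow> 'k mpoly"
          using that by (induction M rule: finite_induct) (auto intro: polys_in_add)
        ultimately show ?thesis by simp
      qed
      ultimately show ?thesis using that by blast
    qed
    have "c \<in> Q"
      using primeideal_poly_ringD[OF Q X_in_polys_in[OF ab(1)], of c] a c D less.prems(1) by blast
    obtain e u where u: "m = e + u" "e \<in> monomials (X a :: 'k mpoly)" "u \<in> monomials c"
      using less.prems(3) keys_mult[of "X a" c] unfolding c(2) by blast
    have "e = Poly_Mapping.single a 1" using u(2) by (simp add: X_def)
    then have "Poly_Mapping.lookup u a < Poly_Mapping.lookup m a" by (simp add: u(1) lookup_add)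
    then show False by (rule less.hyps[OF _ \<open>c \<in> Q\<close> c(1) u(3)])
  qed
  then have "monomials h = {}" if "h \<in> Q \<inter> ?D" for h using that by blast
  then have "Q \<inter> ?D \<subseteq> {0}" by auto
  then have "Q\<^sub>1 = Q"
    using primes_over_zero_incomparable[OF ab(2) Q1 Q] chain(1,2) by blast
  then show False using chain(2) by blast
qed

text \<open>
  In a strict chain of four primes ending in \<open>(x\<^sub>a, x\<^sub>b)\<close>, the second is nonzero, so the third
  contains both variables and cannot be smaller than the fourth.
\<close>

lemma height_monomial_prime_pair_le:
  assumes ab: "a \<in> {1..n}" "b \<in> {1..n}"
  shows "height (poly_ring n) (monomial_prime n {a, b} :: ('k::field) mpoly set) \<le> 2"
  unfolding height_def
proof (rule Sup_least, clarify)
  fix k and Q :: "nat \<Rightarrow> 'k mpoly set"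
  assume prime: "\<forall>i\<le>k. primeideal (Q i) (poly_ring n)" and strict: "\<forall>i<k. Q i \<subset> Q (Suc i)"
    and top: "Q k = monomial_prime n {a, b}"
  have "k \<le> 2"
  proof (rule ccontr)
    assume "\<not> k \<le> 2"
    then obtain j where k: "k = Suc (Suc (Suc j))" by (metis add_2_eq_Suc less_imp_Suc_add not_le)
    have prime': "primeideal (Q i) (poly_ring n)" if "i \<le> Suc (Suc j)" for i
      using prime that k by simp
    have strict': "Q i \<subset> Q (Suc i)" if "i \<le> Suc (Suc j)" for i using strict that k by simp
    have "0 \<in> Q j" by (rule ideal_poly_ringD(2)[OF primeideal.axioms(1)[OF prime']]) simp
    then have ne: "Q (Suc j) \<noteq> {0}" using strict'[of j] by auto
    have sub: "Q (Suc (Suc j)) \<subset> monomial_prime n {a, b}"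
      using strict'[of "Suc (Suc j)"] top k by simp
    have swap: "Q (Suc (Suc j)) \<subseteq> monomial_prime n {b, a}" using sub by (simp add: insert_commute)
    have "X a \<in> Q (Suc (Suc j))"
      by (rule variable_in_top_of_chain[OF ab prime' prime' ne strict']) (use sub in auto)
    moreover have "X b \<in> Q (Suc (Suc j))"
      by (rule variable_in_top_of_chain[OF ab(2,1) prime' prime' ne strict']) (use swap in auto)
    ultimately
    have "monomial_prime n {a, b} \<subseteq> Q (Suc (Suc j))"
      unfolding monomial_prime_def
      by (intro ring.genideal_minimal cring.axioms(1) poly_ring_cring primeideal.axioms(1)[OF prime'])
        auto
    then show False using sub by auto
  qed
  then show "enat k \<le> 2" by (simp only: numeral_eq_enat enat_ord_simps)
qed

lemma height_monomial_prime_pair: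
  assumes "F \<subseteq> {1..n}" "card F = 2"
  shows "height (poly_ring n) (monomial_prime n F :: ('k::field) mpoly set) = 2"
proof (rule antisym)
  obtain a b where F: "F = {a, b}" using assms(2) by (auto simp: card_2_iff)
  then have "a \<in> {1..n}" "b \<in> {1..n}" using assms(1) by auto
  then show "height (poly_ring n) (monomial_prime n F :: 'k mpoly set) \<le> 2"
    unfolding F by (rule height_monomial_prime_pair_le)
  show "2 \<le> height (poly_ring n) (monomial_prime n F :: 'k mpoly set)"
    using card_le_height_monomial_prime[OF assms(1), where ?'k = 'k]
    unfolding assms(2) by (simp only: numeral_eq_enat)
qed

section \<open>The primary decomposition of the complementary edge ideal\<close>

definition triangles :: "nat set set \<Rightarrow> nat set set" where
  "triangles E = {T. card T = 3 \<and> (\<forall>e. e \<subseteq> T \<and> card e = 2 \<longrightarrow> e \<in> E)}"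

lemma K3_free_iff_triangles: "K3_free E \<longleftrightarrow> triangles E = {}"
proof
  assume free: "K3_free E"
  show "triangles E = {}"
  proof (rule ccontr)
    assume "triangles E \<noteq> {}"
    then obtain T where T: "card T = 3" "\<And>e. e \<subseteq> T \<Longrightarrow> card e = 2 \<Longrightarrow> e \<in> E"
      by (auto simp: triangles_def)
    obtain i j k where ijk: "T = {i, j, k}" "i \<noteq> j" "j \<noteq> k" "i \<noteq> k"
      using T(1) by (auto simp: card_3_iff)
    then have "{i, j} \<in> E" "{j, k} \<in> E" "{i, k} \<in> E" by (auto intro!: T(2))
    then show False using free ijk by (auto simp: K3_free_def)
  qed
next
  assume none: "triangles E = {}"
  show "K3_free E"
    unfolding K3_free_def
  proof (rule notI, elim exE conjE)
    fix i j k assume ijk: "i \<noteq> j" "j \<noteq> k" "i \<noteq> k" "{i, j} \<in> E" "{j, k} \<in> E" "{i, k} \<in> E"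
    have "e \<in> E" if e: "e \<subseteq> {i, j, k}" "card e = 2" for e
    proof -
      obtain x y where "e = {x, y}" "x \<noteq> y" using e(2) by (auto simp: card_2_iff)
      then show ?thesis using e(1) ijk by (auto simp: insert_commute)
    qed
    then have "{i, j, k} \<in> triangles E" using ijk by (auto simp: triangles_def)
    then show False using none by auto
  qed
qed

lemma complement_graph_eq:
  "complement_graph n E = {F. F \<subseteq> {1..n} \<and> card F = 2 \<and> F \<notin> E}"
  unfolding complement_graph_def card_2_iff by auto blast

text \<open>
  For a nonempty graph without isolated vertices these are the minimal vertex sets that are not
  contained in an edge.
\<close>

definition minimal_nonfaces :: "nat \<Rightarrow> nat set set \<Rightarrow> nat set set" where
  "minimal_nonfaces n E = complement_graph n E \<union> triangles E"

lemma minimal_nonfaces_subset: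
  assumes "simple_graph n E" shows "minimal_nonfaces n E \<subseteq> Pow {1..n} - {{}}"
proof -
  have "T \<subseteq> {1..n}" if "T \<in> triangles E" for T
  proof
    fix i assume "i \<in> T"
    have "\<not> T \<subseteq> {i}" using that card_mono[of "{i}" T] by (auto simp: triangles_def)
    then obtain j where "j \<in> T" "j \<noteq> i" by auto
    then have "{i, j} \<in> E" using that \<open>i \<in> T\<close> by (auto simp: triangles_def)
    then show "i \<in> {1..n}" using assms by (auto simp: simple_graph_def)
  qed
  then show ?thesis by (auto simp: minimal_nonfaces_def complement_graph_eq triangles_def)
qed

lemma minimal_nonfaces_antichain:
  assumes "F \<in> minimal_nonfaces n E" "G \<in> minimal_nonfaces n E" "F \<subseteq> G"
  shows "F = G"
proof -
  have G: "card G = 2 \<or> card G = 3" "card F = 2 \<or> card F = 3"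
    using assms by (auto simp: minimal_nonfaces_def complement_graph_eq triangles_def)
  then have fin: "finite G" by (auto intro: card_ge_0_finite)
  have "\<not> (card F = 2 \<and> card G = 3)"
    using assms by (auto simp: minimal_nonfaces_def complement_graph_eq triangles_def)
  then have "card G \<le> card F" using G card_mono[OF fin assms(3)] by auto
  then show ?thesis using card_seteq[OF fin assms(3)] by simp
qed

text \<open>
  A set with at least three elements contains a three-element set, which is a triangle or contains
  a nonedge. A smaller set is empty, a single vertex (which lies on an edge) or a pair, which is
  an edge or a nonedge.
\<close>

lemma contained_in_edge_iff:
  assumes E: "simple_graph n E" "\<not> has_isolated_vertex n E" "E \<noteq> {}" and T: "T \<subseteq> {1..n}"
  shows "(\<exists>e\<in>E. T \<subseteq> e) \<longleftrightarrow> \<not> (\<exists>F\<in>minimal_nonfaces n E. F \<subseteq> T)"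
proof
  assume "\<exists>e\<in>E. T \<subseteq> e"
  then obtain e where e: "e \<in> E" "T \<subseteq> e" "card e = 2" using E by (auto simp: simple_graph_def)
  then have fin: "finite e" by (auto intro: card_ge_0_finite)
  show "\<not> (\<exists>F\<in>minimal_nonfaces n E. F \<subseteq> T)"
  proof
    assume "\<exists>F\<in>minimal_nonfaces n E. F \<subseteq> T"
    then obtain F where F: "F \<in> minimal_nonfaces n E" "F \<subseteq> e" using e by auto
    then have "card F \<le> 2" using card_mono[OF fin F(2)] e by simp
    then have "card F = 2" "F \<notin> E" using F by (auto simp: minimal_nonfaces_def complement_graph_eq triangles_def)
    then show False using card_subset_eq[OF fin F(2)] e by simp
  qed
next
  assume none: "\<not> (\<exists>F\<in>minimal_nonfaces n E. F \<subseteq> T)"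
  then have pairs: "e \<in> E" if "e \<subseteq> T" "card e = 2" for e
    using that T by (auto simp: minimal_nonfaces_def complement_graph_eq)
  have fin: "finite T" using T finite_subset by blast
  have "card T \<le> 2"
  proof (rule ccontr)
    assume "\<not> card T \<le> 2"
    then obtain U where "U \<subseteq> T" "card U = 3" using obtain_subset_with_card_n[of 3 T] by auto
    then have "U \<in> triangles E" using pairs by (auto simp: triangles_def)
    then show False using none \<open>U \<subseteq> T\<close> by (auto simp: minimal_nonfaces_def)
  qed
  then consider "card T = 0" | "card T = 1" | "card T = 2" by linarith
  then show "\<exists>e\<in>E. T \<subseteq> e"
  proof cases
    case 1
    then show ?thesis using fin E by auto
  next
    case 2
    then obtain i where "T = {i}" by (auto simp: card_1_singleton_iff)
    then show ?thesis using T E by (auto simp: has_isolated_vertex_def)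
  next
    case 3
    then show ?thesis using pairs by auto
  qed
qed

lemma complementary_edge_ideal_Inter:
  assumes E: "simple_graph n E" "\<not> has_isolated_vertex n E" "E \<noteq> {}"
  shows "complementary_edge_ideal n E = carrier (poly_ring n) \<inter>
    \<Inter>((monomial_prime n :: nat set \<Rightarrow> ('k::field) mpoly set) ` minimal_nonfaces n E)"
proof -
  have sub: "F \<subseteq> {1..n}" if "F \<in> minimal_nonfaces n E" for F using that minimal_nonfaces_subset[OF E(1)] by auto
  have key: "(\<exists>e\<in>E. {1..n} - e \<subseteq> vars m) \<longleftrightarrow> (\<forall>F\<in>minimal_nonfaces n E. F \<inter> vars m \<noteq> {})"
    if "vars m \<subseteq> {1..n}" for m
  proof -
    have "(\<exists>e\<in>E. {1..n} - e \<subseteq> vars m) \<longleftrightarrow> (\<exists>e\<in>E. {1..n} - vars m \<subseteq> e)" by blast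
    also have "\<dots> \<longleftrightarrow> \<not> (\<exists>F\<in>minimal_nonfaces n E. F \<subseteq> {1..n} - vars m)"
      by (intro contained_in_edge_iff E) auto
    also have "\<dots> \<longleftrightarrow> (\<forall>F\<in>minimal_nonfaces n E. F \<inter> vars m \<noteq> {})" using sub by blast
    finally show ?thesis .
  qed
  show ?thesis
    unfolding carrier_poly_ring
  proof (rule Set.set_eqI)
    fix p :: "'k mpoly"
    have vars: "vars m \<subseteq> {1..n}" if "p \<in> polys_in {1..n}" "m \<in> monomials p" for m
      using that unfolding polys_in_def by blast
    have "p \<in> complementary_edge_ideal n E \<longleftrightarrow>
        p \<in> polys_in {1..n} \<and> (\<forall>m\<in>monomials p. \<exists>e\<in>E. {1..n} - e \<subseteq> vars m)"
      unfolding complementary_edge_ideal_eq[OF E(1)] squarefree_ideal_def by blast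
    also have "\<dots> \<longleftrightarrow> p \<in> polys_in {1..n} \<and> (\<forall>m\<in>monomials p. \<forall>F\<in>minimal_nonfaces n E. F \<inter> vars m \<noteq> {})"
      using vars key by blast
    also have "\<dots> \<longleftrightarrow> p \<in> polys_in {1..n} \<and> (\<forall>F\<in>minimal_nonfaces n E. p \<in> monomial_prime n F)"
      using monomial_prime_eq[OF sub, where ?'k = 'k] by blast
    finally show "p \<in> complementary_edge_ideal n E \<longleftrightarrow>
        p \<in> polys_in {1..n} \<inter> \<Inter>(monomial_prime n ` minimal_nonfaces n E)" by blast
  qed
qed

text \<open>
  The product of the variables outside \<open>F\<close> lies in \<open>P\<^sub>G\<close> iff \<open>G\<close> is not contained in \<open>F\<close>; by
  the antichain property it avoids \<open>P\<^sub>F\<close> and no other prime of the family.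
\<close>

lemma irredundant_primes_monomial_primes:
  assumes sub: "Fs \<subseteq> Pow {1..n}" and anti: "\<And>F G. F \<in> Fs \<Longrightarrow> G \<in> Fs \<Longrightarrow> F \<subseteq> G \<Longrightarrow> F = G"
  shows "irredundant_primes (poly_ring n) ((monomial_prime n :: nat set \<Rightarrow> ('k::field) mpoly set) ` Fs)"
  unfolding irredundant_primes_def
proof (intro conjI ballI)
  show "finite ((monomial_prime n :: nat set \<Rightarrow> 'k mpoly set) ` Fs)"
    using sub finite_subset by blast
  show "primeideal P (poly_ring n)" if "P \<in> monomial_prime n ` Fs" for P :: "'k mpoly set"
    using that sub primeideal_monomial_prime by blast
  fix P :: "'k mpoly set" assume "P \<in> monomial_prime n ` Fs"
  then obtain F where F: "F \<in> Fs" "P = monomial_prime n F" by auto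
  let ?u = "\<Prod>j\<in>{1..n} - F. X j :: 'k mpoly"
  have u: "?u = Poly_Mapping.single (indicator_exponent ({1..n} - F)) 1" by (simp add: prod_X)
  have vars: "vars (indicator_exponent ({1..n} - F)) = {1..n} - F" by (simp add: vars_indicator_exponent)
  have mem: "?u \<in> monomial_prime n G \<longleftrightarrow> \<not> G \<subseteq> F" if "G \<in> Fs" for G
  proof -
    have G: "G \<subseteq> {1..n}" using that sub by blast
    have "?u \<in> monomial_prime n G \<longleftrightarrow> G \<inter> ({1..n} - F) \<noteq> {}"
      unfolding monomial_prime_eq[OF G] u using vars by (simp add: polys_in_single)
    then show ?thesis using G by blast
  qed
  have "?u \<in> carrier (poly_ring n) \<inter> \<Inter>(monomial_prime n ` Fs - {P})"
  proof -
    have "?u \<in> polys_in {1..n}" unfolding u by (rule polys_in_single) (unfold vars, blast)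
    moreover have "?u \<in> monomial_prime n G" if "G \<in> Fs" "monomial_prime n G \<noteq> P" for G
      using mem[OF that(1)] anti[OF that(1) F(1)] that(2) F(2) by blast
    ultimately show ?thesis by auto
  qed
  moreover have "?u \<notin> P" using mem F by auto
  ultimately show "\<not> carrier (poly_ring n) \<inter> \<Inter>(monomial_prime n ` Fs - {P}) \<subseteq> P" by blast
qed

text \<open>
  The definite description in \<open>alexander_dual\<close> is justified here: any family of sets that gives a
  minimal primary decomposition of \<open>I\<close> consists of the sets \<open>F\<close> for which \<open>P\<^sub>F\<close> is an associated
  prime of \<open>I\<close>, and \<open>F\<close> is determined by \<open>P\<^sub>F\<close>.
\<close>

lemma alexander_dual_Inter:
  fixes I :: "('k::field) mpoly set"
  assumes sub: "Fs \<subseteq> Pow {1..n} - {{}}"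
    and irr: "irredundant_primes (poly_ring n) ((monomial_prime n :: nat set \<Rightarrow> 'k mpoly set) ` Fs)"
    and I: "I = carrier (poly_ring n) \<inter> \<Inter>(monomial_prime n ` Fs)"
  shows "alexander_dual n I = squarefree_ideal n Fs"
proof -
  interpret cring "poly_ring n :: 'k mpoly ring" by (rule poly_ring_cring)
  let ?mp = "monomial_prime n :: nat set \<Rightarrow> 'k mpoly set"
  have mpd: "minimal_primary_decomposition (poly_ring n) I (?mp ` Gs) \<longleftrightarrow>
      irredundant_primes (poly_ring n) (?mp ` Gs) \<and> I = carrier (poly_ring n) \<inter> \<Inter>(?mp ` Gs)"
    if "Gs \<subseteq> Pow {1..n} - {{}}" for Gs
    by (intro minimal_primary_decomposition_iff_irredundant_primes)
      (use that primeideal_monomial_prime in blast)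
  have "(THE Gs. Gs \<subseteq> Pow {1..n} - {{}} \<and> minimal_primary_decomposition (poly_ring n) I (?mp ` Gs)) = Fs"
  proof (rule the_equality)
    show "Fs \<subseteq> Pow {1..n} - {{}} \<and> minimal_primary_decomposition (poly_ring n) I (?mp ` Fs)"
      using sub irr I mpd[OF sub] by simp
    fix Gs assume Gs: "Gs \<subseteq> Pow {1..n} - {{}} \<and> minimal_primary_decomposition (poly_ring n) I (?mp ` Gs)"
    then have "?mp ` Gs = associated_primes (poly_ring n) I"
      using mpd[of Gs] associated_primes_Inter by metis
    also have "\<dots> = ?mp ` Fs" using associated_primes_Inter[OF irr] I by simp
    finally show "Gs = Fs"
      using inj_on_image_eq_iff[OF inj_on_monomial_prime, of Gs n Fs] Gs sub by blast
  qed
  then show ?thesis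
    unfolding alexander_dual_def Let_def by (simp only:) (rule Idl_squarefree, use sub in auto)
qed

theorem corollary2p4:
  fixes n :: nat and E :: "nat set set" and I\<^sub>c :: "('k::field) mpoly set"
  assumes "simple_graph n E"
    and "\<not> has_isolated_vertex n E"
    and "\<not> complete_graph n E"
    and "I\<^sub>c = complementary_edge_ideal n E"
  shows "(unmixed (poly_ring n) I\<^sub>c \<longleftrightarrow>
            alexander_dual n I\<^sub>c = edge_ideal n (complement_graph n E))
       \<and> (alexander_dual n I\<^sub>c = edge_ideal n (complement_graph n E) \<longleftrightarrow> K3_free E)"
proof -
  interpret cring "poly_ring n :: 'k mpoly ring" by (rule poly_ring_cring)
  let ?Fs = "minimal_nonfaces n E"
  let ?mp = "monomial_prime n :: nat set \<Rightarrow> 'k mpoly set"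
  obtain i j where ij: "i \<in> {1..n}" "j \<in> {1..n}" "i \<noteq> j" "{i, j} \<notin> E"
    using assms(3) by (auto simp: complete_graph_def)
  have nonedge: "{i, j} \<in> complement_graph n E" using ij by (auto simp: complement_graph_def)
  have "E \<noteq> {}" using ij assms(2) by (auto simp: has_isolated_vertex_def)
  note I = complementary_edge_ideal_Inter[OF assms(1,2) this, where ?'k = 'k, folded assms(4)]
  have sub: "?Fs \<subseteq> Pow {1..n} - {{}}" by (rule minimal_nonfaces_subset[OF assms(1)])
  have irr: "irredundant_primes (poly_ring n) (?mp ` ?Fs)"
    using sub minimal_nonfaces_antichain by (intro irredundant_primes_monomial_primes) auto
  have ass: "associated_primes (poly_ring n) I\<^sub>c = ?mp ` ?Fs"
    unfolding I by (rule associated_primes_Inter[OF irr])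
  have dual: "alexander_dual n I\<^sub>c = squarefree_ideal n ?Fs" by (rule alexander_dual_Inter[OF sub irr I])
  have "simple_graph n (complement_graph n E)" by (auto simp: simple_graph_def complement_graph_eq)
  note edge = edge_ideal_eq[OF this, where ?'k = 'k]
  have height2: "height (poly_ring n) (?mp F) = 2" if "F \<in> complement_graph n E" for F
    using that by (intro height_monomial_prime_pair) (auto simp: complement_graph_eq)
  have "unmixed (poly_ring n) I\<^sub>c \<longleftrightarrow> triangles E = {}"
  proof
    assume unm: "unmixed (poly_ring n) I\<^sub>c"
    show "triangles E = {}"
    proof (rule ccontr)
      assume "triangles E \<noteq> {}"
      then obtain T where T: "T \<in> triangles E" by auto
      then have "height (poly_ring n) (?mp T) = height (poly_ring n) (?mp {i, j})"
        using unm nonedge ass by (auto simp: unmixed_def minimal_nonfaces_def)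
      also have "\<dots> = 2" by (rule height2[OF nonedge])
      finally have "enat (card T) \<le> 2"
        using card_le_height_monomial_prime[of T n, where ?'k = 'k] T sub by (auto simp: minimal_nonfaces_def)
      then show False using T by (simp add: triangles_def numeral_eq_enat)
    qed
  next
    assume "triangles E = {}"
    then show "unmixed (poly_ring n) I\<^sub>c"
      using height2 by (auto simp: unmixed_def ass minimal_nonfaces_def)
  qed
  moreover have "alexander_dual n I\<^sub>c = edge_ideal n (complement_graph n E) \<longleftrightarrow> triangles E = {}"
  proof
    assume eq: "alexander_dual n I\<^sub>c = edge_ideal n (complement_graph n E)"
    show "triangles E = {}"
    proof (rule ccontr)
      assume "triangles E \<noteq> {}"
      then obtain T where T: "T \<in> triangles E" by auto
      then have TFs: "T \<in> ?Fs" by (simp add: minimal_nonfaces_def)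
      then have "(\<Prod>j\<in>T. X j :: 'k mpoly) \<in> squarefree_ideal n (complement_graph n E)"
        using eq dual edge prod_X_in_squarefree_ideal_iff[of T n ?Fs, where ?'k = 'k] sub
        by (metis (no_types) Diff_subset PowD order_refl subset_iff)
      then obtain F where "F \<in> complement_graph n E" "F \<subseteq> T"
        using prod_X_in_squarefree_ideal_iff[of T n _, where ?'k = 'k] sub TFs by blast
      then show False using T by (auto simp: complement_graph_eq triangles_def)
    qed
  next
    assume "triangles E = {}"
    then show "alexander_dual n I\<^sub>c = edge_ideal n (complement_graph n E)"
      by (simp add: dual edge minimal_nonfaces_def)
  qed
  ultimately show ?thesis by (simp add: K3_free_iff_triangles)
qed

end
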